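(* Consider the bilinear system on $\mathrm{GL}^+(n)$ $$\dot X(t)=AX(t)+\Big(\sum_{k=1}^m u_k(t)E_{i_kj_k}\Big)X(t),\qquad X(0)=I_n,$$ with $A\in\mathfrak{gl}(n)$ and $E_{i_kj_k}\in\{E_{ij}:1\le i,j\le n\}$ for $k=1,\dots,m$ (the case $i_k=j_k$ being allowed). Suppose $A=0$. Then the system is controllable on the Lie group $\mathrm{GL}^+(n)$ if and only if the digraph $\mathcal{G}^{\ast}_{\rm contr}$ is a strongly connected digraph with at least one self-loop.
   Context: $\mathrm{GL}^+(n)$ is the connected component containing the identity $I_n$ of the group of real invertible $n\times n$ matrices, and its Lie algebra is $\mathfrak{gl}(n)=\mathbb{R}^{n\times n}$. $E_{ij}\in\mathbb{R}^{n\times n}$ has $(i,j)$-entry $1$ and all other entries $0$. The controls $u_k(t)\in\mathbb{R}$ are piecewise constant signals. For $T\ge 0$, $\mathcal{R}_T(I_n)$ is the set of all terminal points $X(T)$ of solutions of the system with $X(0)=I_n$ (over all admissible controls), and $\mathcal{R}(I_n)=\bigcup_{T\ge 0}\mathcal{R}_T(I_n)$. The system is controllable on $\mathrm{GL}^+(n)$ if $\mathcal{R}(I_n)=\mathrm{GL}^+(n)$. Let $\mathrm{V}=\{1,\dots,n\}$. The controlled interaction graph is the digraph $\mathcal{G}^{\ast}_{\rm contr}=(\mathrm{V},\mathcal{E}^{\ast}_{\rm contr})$ with arc set $\mathcal{E}^{\ast}_{\rm contr}=\{(i_1,j_1),\dots,(i_m,j_m)\}$; it may have self-loops $(i,i)$.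 A digraph is strongly connected if every two nodes are mutually reachable by directed paths; a node is reachable from itself. *)

theory Defs
  imports
    "Graph_Theory.Digraph_Component"
    "Graph_Theory.Pair_Digraph"
    "HOL-Analysis.Analysis"
begin

text \<open>The index type \<open>'n\<close> plays the role of \<open>{1,\<dots>,n}\<close>. The control arcs are
  \<open>(i k, j k)\<close> for \<open>k \<in> {1..m}\<close>; values of \<open>i\<close>, \<open>j\<close> and \<open>u\<close> at other indices \<open>k\<close> play no role.\<close>

definition GL_plus :: "(real^'n^'n) set" where
  "GL_plus = connected_component_set {M. invertible M} (mat 1)"

definition matrix_unit :: "'n::finite \<Rightarrow> 'n \<Rightarrow> real^'n^'n" where
  "matrix_unit p q = (\<chi> a b. if a = p \<and> b = q then 1 else 0)"

text \<open>Finitely many switching times; the values at the switching times themselves are arbitrary.\<close>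

definition piecewise_constant_on :: "(real \<Rightarrow> real) \<Rightarrow> real set \<Rightarrow> bool" where
  "piecewise_constant_on f I \<longleftrightarrow>
     (\<exists>D. finite D \<and> (\<forall>a b. {a..b} \<subseteq> I - D \<longrightarrow> f constant_on {a..b}))"

text \<open>As the right-hand side may jump at the switching times, a trajectory is a continuous curve in
  the state space satisfying the differential equation at all but finitely many times.\<close>

definition trajectory ::
  "real^'n^'n \<Rightarrow> nat \<Rightarrow> (nat \<Rightarrow> 'n) \<Rightarrow> (nat \<Rightarrow> 'n) \<Rightarrow> (nat \<Rightarrow> real \<Rightarrow> real) \<Rightarrow> real \<Rightarrow>
   (real \<Rightarrow> real^'n^'n) \<Rightarrow> bool" where
  "trajectory A m i j u T X \<longleftrightarrow>
     continuous_on {0..T} X \<and> X ` {0..T} \<subseteq> GL_plus \<and> X 0 = mat 1 \<and>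
     (\<exists>D. finite D \<and> (\<forall>t \<in> {0..T} - D.
        (X has_vector_derivative
           (A ** X t + (\<Sum>k\<in>{1..m}. u k t *\<^sub>R matrix_unit (i k) (j k)) ** X t))
        (at t within {0..T})))"

definition reachable_set_at ::
  "real^'n^'n \<Rightarrow> nat \<Rightarrow> (nat \<Rightarrow> 'n) \<Rightarrow> (nat \<Rightarrow> 'n) \<Rightarrow> real \<Rightarrow> (real^'n^'n) set" where
  "reachable_set_at A m i j T =
     {X T | X u. (\<forall>k\<in>{1..m}. piecewise_constant_on (u k) {0..T}) \<and> trajectory A m i j u T X}"

definition reachable_set ::
  "real^'n^'n \<Rightarrow> nat \<Rightarrow> (nat \<Rightarrow> 'n) \<Rightarrow> (nat \<Rightarrow> 'n) \<Rightarrow> (real^'n^'n) set" where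
  "reachable_set A m i j = (\<Union>T\<in>{0..}. reachable_set_at A m i j T)"

definition controllable ::
  "real^'n^'n \<Rightarrow> nat \<Rightarrow> (nat \<Rightarrow> 'n) \<Rightarrow> (nat \<Rightarrow> 'n) \<Rightarrow> bool" where
  "controllable A m i j \<longleftrightarrow> reachable_set A m i j = GL_plus"

definition controlled_graph :: "nat \<Rightarrow> (nat \<Rightarrow> 'n) \<Rightarrow> (nat \<Rightarrow> 'n) \<Rightarrow> 'n pair_pre_digraph" where
  "controlled_graph m i j = \<lparr> pverts = UNIV, parcs = {(i k, j k) | k. k \<in> {1..m}} \<rparr>"

definition has_self_loop :: "'n pair_pre_digraph \<Rightarrow> bool" where
  "has_self_loop G \<longleftrightarrow> (\<exists>v. (v, v) \<in> parcs G)"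

end

theory Submission
  imports Defs
begin

text \<open>
  Write \<open>E p q\<close> for the matrix units. Along an arc \<open>(p, q)\<close> with \<open>p \<noteq> q\<close> the system can follow
  the one-parameter group \<open>I + t E p q\<close> of transvections; along a self-loop \<open>(p, p)\<close> it can follow
  the dilations \<open>I + (exp t - 1) E p p\<close>. With zero drift, concatenating such pieces reaches all
  products of these matrices (\<open>arc_products_reachable\<close>), so controllability follows once these
  products exhaust \<open>GL_plus\<close>.

  Suppose the graph is strongly connected with a self-loop at \<open>v\<close>. The commutator of transvections
  for \<open>(p, y)\<close> and \<open>(y, q)\<close> is a transvection for \<open>(p, q)\<close>, so following directed paths yields
  every transvection (\<open>transvection_in_arc_products\<close>). Three transvections compose to a quarter turn in the
  plane of two coordinates, and conjugating by it carries the dilations at \<open>v\<close> to any other node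
  (\<open>dilation_in_arc_products\<close>). By Gaussian elimination every invertible matrix is a product of
  transvections, positive dilations and, possibly, one fixed reflection; the sign of the determinant
  decides whether the reflection occurs, so every matrix of positive determinant is reached
  (\<open>det_pos_in_arc_products\<close>), and all of \<open>GL_plus\<close> has positive determinant.

  Both conditions are necessary because each failure produces an invariant. Without self-loops the
  coefficient matrix is traceless, and by Liouville's formula the determinant stays \<open>1\<close>
  (\<open>reachable_det_1\<close>). If \<open>q\<close> cannot be reached from \<open>p\<close>, the entries in column \<open>q\<close> whose rows are
  reachable from \<open>p\<close> satisfy a closed linear system with zero initial value, so by Gronwall's argument
  the entry \<open>(p, q)\<close> stays \<open>0\<close> (\<open>reachable_entry_0\<close>). But \<open>GL_plus\<close> contains dilations of
  determinant different from \<open>1\<close> and transvections for every pair \<open>(p, q)\<close>.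
\<close>

section \<open>Elementary matrices along the arcs of a digraph\<close>

text \<open>A transvection for \<open>p \<noteq> q\<close>, and the scaling of coordinate \<open>p\<close> by \<open>1 + c\<close> for \<open>p = q\<close>.\<close>

definition elementary :: "'n::finite \<Rightarrow> 'n \<Rightarrow> real \<Rightarrow> real^'n^'n" where
  "elementary p q c = mat 1 + c *\<^sub>R matrix_unit p q"

lemma matrix_unit_mult:
  "matrix_unit p q ** matrix_unit r s = (if q = r then matrix_unit p s else 0)"
proof -
  have "(\<Sum>k\<in>UNIV. matrix_unit p q $ a $ k * matrix_unit r s $ k $ b)
      = (\<Sum>k\<in>UNIV. if k = q then (if a = p \<and> q = r \<and> b = s then 1 else 0) else 0)" for a b
    by (rule sum.cong) (auto simp: matrix_unit_def)
  then show ?thesis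
    by (auto simp: matrix_matrix_mult_def vec_eq_iff matrix_unit_def)
qed

lemma matrix_mult_scaleR:
  fixes A B :: "real^'n^'n"
  shows "(c *\<^sub>R A) ** B = c *\<^sub>R (A ** B)" "A ** (c *\<^sub>R B) = c *\<^sub>R (A ** B)"
  by (simp_all add: matrix_matrix_mult_def vec_eq_iff sum_distrib_left mult_ac)

lemma matrix_add_mult_distrib:
  fixes A B C :: "real^'n^'n"
  shows "(A + B) ** C = A ** C + B ** C"
  by (simp add: matrix_matrix_mult_def vec_eq_iff sum.distrib algebra_simps)

lemma matrix_mult_diff:
  fixes A B C :: "real^'n^'n"
  shows "(A - B) ** C = A ** C - B ** C" "C ** (A - B) = C ** A - C ** B"
  by (simp_all add: matrix_matrix_mult_def vec_eq_iff sum_subtractf algebra_simps)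

text \<open>The product \<open>*\<close> of vectors is entrywise. The simplifier collects equal summands into such
  products with a numeral, and this lemma turns them back into scalar multiples.\<close>

lemma matrix_numeral_eq_scaleR:
  fixes A :: "real^'n^'n"
  shows "A * numeral k = numeral k *\<^sub>R A" "numeral k * A = numeral k *\<^sub>R A"
  by (simp_all add: vec_eq_iff)

lemma matrix_unit_mult_nth: "(matrix_unit p q ** A) $ a $ b = (if a = p then A $ q $ b else 0)"
proof -
  have "(\<Sum>k\<in>UNIV. matrix_unit p q $ a $ k * A $ k $ b)
      = (\<Sum>k\<in>UNIV. if k = q then (if a = p then A $ q $ b else 0) else 0)"
    by (rule sum.cong) (auto simp: matrix_unit_def)
  then show ?thesis by (simp add: matrix_matrix_mult_def)
qed

lemmas unit_algebra = matrix_numeral_eq_scaleR matrix_mult_diff matrix_add_ldistrib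
  matrix_add_mult_distrib matrix_mult_scaleR matrix_unit_mult

lemma elementary_commutator:
  assumes "p \<noteq> q" "q \<noteq> r" "p \<noteq> r"
  shows "elementary p q c ** (elementary q r 1 ** (elementary p q (-c) ** elementary q r (-1))) = elementary p r c"
  using assms by (simp add: elementary_def unit_algebra algebra_simps)

text \<open>In the coordinates \<open>p\<close>, \<open>q\<close> this is the rotation by a right angle, in its usual factorization
  into three shears.\<close>

definition quarter_turn :: "'n::finite \<Rightarrow> 'n \<Rightarrow> real^'n^'n" where
  "quarter_turn p q = elementary p q 1 ** (elementary q p (-1) ** elementary p q 1)"

lemma quarter_turn_eq:
  assumes "p \<noteq> q"
  shows "quarter_turn p q = mat 1 - matrix_unit p p - matrix_unit q q + matrix_unit p q - matrix_unit q p"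
  using assms by (simp add: quarter_turn_def elementary_def unit_algebra algebra_simps)

text \<open>The quarter turn exchanges the two coordinate axes, hence moves a dilation from one to the other;
  \<open>quarter_turn q p\<close> is its inverse.\<close>

lemma quarter_turn_conj:
  assumes "p \<noteq> q"
  shows "quarter_turn p q ** (elementary q q c ** quarter_turn q p) = elementary p p c"
  using assms by (simp add: quarter_turn_eq elementary_def unit_algebra algebra_simps)

text \<open>A half turn reflects both axes. It is how a pair of reflections arises from transvections.\<close>

lemma quarter_turn_square:
  assumes "p \<noteq> q"
  shows "quarter_turn p q ** quarter_turn p q = elementary p p (-2) ** elementary q q (-2)"
proof -
  have "quarter_turn p q ** quarter_turn p q = mat 1 - 2 *\<^sub>R matrix_unit p p - 2 *\<^sub>R matrix_unit q q"
    using assms by (simp add: quarter_turn_eq unit_algebra algebra_simps)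
  also have "\<dots> = elementary p p (-2) ** elementary q q (-2)"
    using assms by (simp add: elementary_def unit_algebra)
  finally show ?thesis .
qed

lemma elementary_nth:
  "elementary p q c $ a $ b = (if a = b then 1 else 0) + (if a = p \<and> b = q then c else 0)"
  by (simp add: elementary_def matrix_unit_def mat_def)

lemma det_elementary: "det (elementary p q c) = (if p = q then 1 + c else 1)"
proof (cases "p = q")
  case True
  have "det (elementary p p c) = (\<Prod>a\<in>UNIV. elementary p p c $ a $ a)"
    by (rule det_diagonal) (auto simp: elementary_nth)
  also have "\<dots> = (\<Prod>a\<in>UNIV. if a = p then 1 + c else 1)"
    by (rule prod.cong) (auto simp: elementary_nth)
  finally show ?thesis using True by simp
next
  case False
  have "elementary p q c = (\<chi> k. if k = p then row p (mat 1) + c *s row q (mat 1) else row k (mat 1))"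
    using False by (auto simp: vec_eq_iff elementary_nth row_def mat_def)
  then show ?thesis using det_row_operation[OF False, where c = c and A = "mat 1"] False by simp
qed

text \<open>The bound \<open>c > -1\<close> on the diagonal keeps the scaling factor \<open>1 + c\<close> positive: these are the
  scalings \<open>exp t\<close> that the flow of a self-loop attains.\<close>

inductive_set arc_products :: "('n::finite \<times> 'n) set \<Rightarrow> (real^'n^'n) set" for R where
  one: "mat 1 \<in> arc_products R"
| step: "M \<in> arc_products R \<Longrightarrow> (p, q) \<in> R \<Longrightarrow> (p = q \<Longrightarrow> c > -1) \<Longrightarrow> elementary p q c ** M \<in> arc_products R"

lemma elementary_in_arc_products:
  assumes "(p, q) \<in> R" "p = q \<Longrightarrow> c > -1"
  shows "elementary p q c \<in> arc_products R"
  using arc_products.step[OF arc_products.one assms] by simp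

lemma arc_products_mult:
  "A \<in> arc_products R \<Longrightarrow> B \<in> arc_products R \<Longrightarrow> A ** B \<in> arc_products R"
  by (induction rule: arc_products.induct) (auto intro: arc_products.step simp flip: matrix_mul_assoc)

lemma arc_products_det_pos: "A \<in> arc_products R \<Longrightarrow> det A > 0"
  by (induction rule: arc_products.induct) (auto simp: det_mul det_elementary)

text \<open>Induction along a directed path from \<open>p\<close> to \<open>q\<close>: each new arc is absorbed by a commutator.
  For \<open>p = q\<close> the matrix is a dilation, which has determinant \<open>1 + c\<close> and for \<open>c \<noteq> 0\<close> is out of
  reach of transvections.\<close>

lemma transvection_in_arc_products:
  assumes "(p, q) \<in> R\<^sup>*"
  shows "p \<noteq> q \<Longrightarrow> elementary p q c \<in> arc_products R"
  using assms
proof (induction arbitrary: c rule: rtrancl_induct)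
  case (step y z)
  consider "p = y" | "y = z" | "p \<noteq> y" "y \<noteq> z" by blast
  then show ?case
  proof cases
    case 3
    then have "elementary p y d \<in> arc_products R" "elementary y z d \<in> arc_products R" for d
      using step elementary_in_arc_products by blast+
    then show ?thesis unfolding elementary_commutator[OF 3 step.prems, symmetric] by (intro arc_products_mult)
  qed (use step elementary_in_arc_products in auto)
qed auto

text \<open>One self-loop suffices, since quarter turns transport its dilations to every coordinate.\<close>

lemma dilation_in_arc_products:
  assumes "\<And>p q. (p, q) \<in> R\<^sup>*" "(v, v) \<in> R" "c > -1"
  shows "elementary w w c \<in> arc_products R"
proof (cases "w = v")
  case False
  then have "quarter_turn w v \<in> arc_products R" "quarter_turn v w \<in> arc_products R"
    unfolding quarter_turn_def by (auto intro!: arc_products_mult transvection_in_arc_products assms)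
  then show ?thesis unfolding quarter_turn_conj[OF False, symmetric]
    using assms by (auto intro!: arc_products_mult elementary_in_arc_products)
qed (use assms elementary_in_arc_products in auto)

lemma arc_products_UNIV_subset:
  assumes "\<And>p q. (p, q) \<in> R\<^sup>*" "(v, v) \<in> R"
  shows "arc_products UNIV \<subseteq> arc_products R"
proof
  fix A :: "real^'a^'a" assume "A \<in> arc_products UNIV" then show "A \<in> arc_products R"
  proof induction
    case (step M p q c)
    then show ?case using dilation_in_arc_products[OF assms] transvection_in_arc_products[OF assms(1)] arc_products_mult by metis
  qed (rule arc_products.one)
qed

section \<open>Matrices of positive determinant\<close>

abbreviation reflection where "reflection v \<equiv> elementary v v (-2)"

lemma reflection_involution: "reflection v ** reflection v = mat 1"
  by (simp add: elementary_def unit_algebra algebra_simps)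

lemma reflection_conj_elementary:
  "\<exists>d. reflection v ** (elementary p q c ** reflection v) = elementary p q d \<and> (p = q \<longrightarrow> d = c)"
proof -
  have "reflection v ** (elementary p q c ** reflection v) = elementary p q (if (p = v) = (q = v) then c else - c)"
    by (auto simp add: elementary_def unit_algebra algebra_simps)
  then show ?thesis by force
qed

text \<open>The reflection normalizes the set of all products: it flips the sign of the transvections that
  involve \<open>v\<close> and commutes with the dilations.\<close>

lemma reflection_conj_arc_products:
  "A \<in> arc_products UNIV \<Longrightarrow> reflection v ** (A ** reflection v) \<in> arc_products UNIV"
proof (induction rule: arc_products.induct)
  case (step M p q c)
  obtain d where d: "reflection v ** (elementary p q c ** reflection v) = elementary p q d" "p = q \<longrightarrow> d = c"
    using reflection_conj_elementary by blast
  have "reflection v ** (elementary p q c ** M ** reflection v) = (reflection v ** (elementary p q c ** reflection v)) ** (reflection v ** (M ** reflection v))"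
    by (metis reflection_involution matrix_mul_assoc matrix_mul_rid)
  then show ?case using d step by (auto intro: arc_products.step)
qed (simp add: reflection_involution arc_products.one)

text \<open>Elementary matrix operations include row swaps and negative scalings, which leave
  the matrices of positive determinant. Allowing one fixed reflection as a last factor gives a
  property that all these operations preserve.\<close>

definition up_to_reflection where
  "up_to_reflection v A \<longleftrightarrow> A \<in> arc_products UNIV \<or> A ** reflection v \<in> arc_products UNIV"

lemma up_to_reflection_mult:
  assumes "up_to_reflection v A" "up_to_reflection v B"
  shows "up_to_reflection v (A ** B)"
proof -
  have 1: "A ** B ** reflection v = (A ** reflection v) ** (reflection v ** (B ** reflection v))"
    "A ** B = (A ** reflection v) ** (reflection v ** (B ** reflection v ** reflection v))"
    "A ** B ** reflection v = A ** (B ** reflection v)"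
    by (metis reflection_involution matrix_mul_assoc matrix_mul_rid matrix_mul_lid)+
  show ?thesis using assms 1 reflection_conj_arc_products[of B v] reflection_conj_arc_products[of "B ** reflection v" v] unfolding up_to_reflection_def
    by (metis arc_products_mult)
qed

lemma quarter_turn_in_arc_products: "p \<noteq> q \<Longrightarrow> quarter_turn p q \<in> arc_products UNIV"
  unfolding quarter_turn_def by (auto intro!: arc_products_mult elementary_in_arc_products)

text \<open>A negative scaling is a reflection times a positive scaling; a reflection at \<open>w \<noteq> v\<close> differs from
  the one at \<open>v\<close> by a half turn.\<close>

lemma up_to_reflection_dilation:
  assumes "c \<noteq> -1"
  shows "up_to_reflection v (elementary w w c)"
proof (cases "c > -1")
  case True then show ?thesis by (simp add: up_to_reflection_def elementary_in_arc_products)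
next
  case False
  have 1: "up_to_reflection v (elementary w w (-2))"
  proof (cases "w = v")
    case True then show ?thesis by (simp add: up_to_reflection_def reflection_involution arc_products.one)
  next
    case False
    then show ?thesis unfolding up_to_reflection_def using quarter_turn_square[OF False] by (metis quarter_turn_in_arc_products arc_products_mult)
  qed
  (* The remaining scaling factor is 1 + (-2 - c) = - (1 + c), which is positive. *)
  have 2: "up_to_reflection v (elementary w w (-2 - c))"
    using assms False by (simp add: up_to_reflection_def elementary_in_arc_products)
  have "elementary w w (-2) ** elementary w w (-2 - c) = elementary w w c"
    by (simp add: elementary_def unit_algebra algebra_simps)
  then show ?thesis using up_to_reflection_mult[OF 1 2] by simp
qed

text \<open>Induction over the set \<open>S\<close> of coordinates whose diagonal entry may differ from \<open>1\<close>, splitting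
  off one dilation at a time.\<close>

lemma up_to_reflection_diagonal:
  assumes "finite S" "\<And>i j. i \<noteq> j \<Longrightarrow> A$i$j = 0" "\<And>i. A$i$i \<noteq> 0" "\<And>i. i \<notin> S \<Longrightarrow> A$i$i = 1"
  shows "up_to_reflection v A"
  using assms
proof (induction arbitrary: A)
  case empty
  then have "A = mat 1" by (auto simp: vec_eq_iff mat_def)
  then show ?case by (simp add: up_to_reflection_def arc_products.one)
next
  case (insert w S)
  define A' where "A' = (\<chi> i j. if i = w \<and> j = w then 1 else A$i$j)"
  have "up_to_reflection v A'" by (rule insert.IH) (use insert.prems in \<open>auto simp: A'_def\<close>)
  moreover have "up_to_reflection v (elementary w w (A$w$w - 1))" by (rule up_to_reflection_dilation) (use insert.prems in auto)
  moreover have "elementary w w (A$w$w - 1) ** A' = A"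
    using insert.prems(1)
    by (auto simp: vec_eq_iff elementary_def matrix_add_mult_distrib matrix_mult_scaleR matrix_unit_mult_nth A'_def)
  ultimately show ?case using up_to_reflection_mult by metis
qed

text \<open>Gaussian elimination, in the form of induction over elementary factors. A singular factor is
  excluded by the determinant, and a swap is a quarter turn followed by a reflection.\<close>

lemma up_to_reflection_invertible: "det A \<noteq> 0 \<Longrightarrow> up_to_reflection v A"
proof (induction A rule: induct_matrix_elementary)
  case (1 A B) then show ?case by (simp add: det_mul up_to_reflection_mult)
next
  case (2 A i) then show ?case using det_zero_row(2) by blast
next
  case (3 A)
  then show ?case using det_diagonal[of A] by (intro up_to_reflection_diagonal[of UNIV]) auto
next
  case (4 m n)
  have "(\<chi> i j. mat 1 $ i $ Transposition.transpose m n j) = quarter_turn m n ** elementary m m (-2)"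
  proof -
    have "quarter_turn m n ** elementary m m (-2) = mat 1 - matrix_unit m m - matrix_unit n n + matrix_unit m n + matrix_unit n m"
      using 4 by (simp add: quarter_turn_eq elementary_def unit_algebra algebra_simps)
    then show ?thesis using 4
      by (auto simp: vec_eq_iff mat_def matrix_unit_def Transposition.transpose_def)
  qed
  moreover have "up_to_reflection v (quarter_turn m n)" using quarter_turn_in_arc_products[OF \<open>m \<noteq> n\<close>] by (simp add: up_to_reflection_def)
  ultimately show ?case by (simp add: up_to_reflection_mult up_to_reflection_dilation)
next
  case (5 m n c)
  have "(\<chi> i j. if i = m \<and> j = n then c else of_bool (i = j)) = elementary m n c"
    using 5 by (auto simp: vec_eq_iff elementary_nth)
  then show ?case using elementary_in_arc_products[of m n UNIV c] 5 by (simp add: up_to_reflection_def)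
qed

lemma det_pos_in_arc_products:
  assumes "det A > 0"
  shows "A \<in> arc_products UNIV"
proof -
  (* Any coordinate may carry the reflection. *)
  fix v :: 'a
  have "\<not> A ** reflection v \<in> arc_products UNIV" using arc_products_det_pos[of "A ** reflection v"] assms by (auto simp: det_mul det_elementary)
  then show ?thesis using up_to_reflection_invertible[of A v] assms by (simp add: up_to_reflection_def)
qed

section \<open>Liouville's formula and Gronwall's inequality\<close>

text \<open>Off the switching times, the value at \<open>t\<close> depends only on which switching times precede \<open>t\<close>, and
  there are finitely many such sets. In particular admissible controls are bounded.\<close>

lemma piecewise_constant_on_finite_image:
  assumes "piecewise_constant_on f {a..b}" shows "finite (f ` {a..b})"
proof -
  obtain D where D: "finite D" "\<forall>x y. {x..y} \<subseteq> {a..b} - D \<longrightarrow> f constant_on {x..y}"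
    using assms unfolding piecewise_constant_on_def by (elim exE conjE) (rule that)
  (* Two times with the same key have no switching time between them. *)
  define key where "key t = {d \<in> D. d < t}" for t
  have le: "f s = f t" if "s \<in> {a..b} - D" "t \<in> {a..b} - D" "key s = key t" "s \<le> t" for s t
  proof -
    have "{s..t} \<subseteq> {a..b} - D"
    proof
      fix x assume x: "x \<in> {s..t}"
      have "x \<notin> D"
      proof
        assume "x \<in> D"
        then have "x \<noteq> s" "x \<noteq> t" using that(1,2) by blast+
        then have "s < x" "x < t" using x by auto
        then have "x \<in> key t" "x \<notin> key s" using \<open>x \<in> D\<close> by (auto simp: key_def)
        then show False using \<open>key s = key t\<close> by simp
      qed
      then show "x \<in> {a..b} - D" using x that(1,2) by auto
    qed
    then show ?thesis using D(2)[rule_format, of s t] \<open>s \<le> t\<close> unfolding constant_on_def by auto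
  qed
  have eq: "f s = f t" if "s \<in> {a..b} - D" "t \<in> {a..b} - D" "key s = key t" for s t
    using le[of s t] le[of t s] that linear[of s t] by metis
  define g where "g K = f (SOME t. t \<in> {a..b} - D \<and> key t = K)" for K
  have "f t = g (key t)" if "t \<in> {a..b} - D" for t
    unfolding g_def by (rule someI2[of _ t]) (use eq that in \<open>blast+\<close>)
  moreover have "key t \<in> Pow D" for t by (auto simp: key_def)
  ultimately have "f ` ({a..b} - D) \<subseteq> g ` Pow D" by (metis image_eqI image_subsetI)
  then have "finite (f ` ({a..b} - D))" using D(1) finite_subset by blast
  moreover have "f ` {a..b} \<subseteq> f ` ({a..b} - D) \<union> f ` D" by auto
  ultimately show ?thesis using D(1) finite_subset by blast
qed

lemma has_vector_derivative_entry:
  assumes "(X has_vector_derivative Y) F"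
  shows "((\<lambda>t. X t $ a $ b) has_vector_derivative Y $ a $ b) F"
  by (intro bounded_linear.has_vector_derivative[OF bounded_linear_vec_nth] assms)

text \<open>The \<open>k\<close>-th term of the product rule for the determinant, summed over all permutations, is a
  determinant with row \<open>k\<close> differentiated.\<close>

lemma sum_permutes_row_replaced:
  fixes X Y :: "real^'n^'n"
  shows "(\<Sum>p | p permutes UNIV. of_int (sign p) * (Y $ k $ p k * (\<Prod>l\<in>UNIV - {k}. X $ l $ p l)))
    = det (\<chi> l. if l = k then Y $ k else X $ l)"
  unfolding det_def
proof (rule sum.cong[OF refl])
  fix p :: "'n \<Rightarrow> 'n"
  have "(\<Prod>l\<in>UNIV. (\<chi> l. if l = k then Y $ k else X $ l) $ l $ p l) = Y $ k $ p k * (\<Prod>l\<in>UNIV - {k}. X $ l $ p l)"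
    by (subst prod.remove[of _ k]) (auto intro!: prod.cong)
  then show "of_int (sign p) * (Y $ k $ p k * (\<Prod>l\<in>UNIV - {k}. X $ l $ p l)) =
    of_int (sign p) * (\<Prod>l\<in>UNIV. (\<chi> l. if l = k then Y $ k else X $ l) $ l $ p l)" by simp
qed

text \<open>Row \<open>k\<close> of \<open>B ** X\<close> combines the rows of \<open>X\<close>; all but the \<open>k\<close>-th create a repeated row and
  contribute nothing.\<close>

lemma det_row_of_product:
  fixes X B :: "real^'n^'n"
  shows "det (\<chi> l. if l = k then (B ** X) $ k else X $ l) = B $ k $ k * det X"
proof -
  have "(B ** X) $ k = (\<Sum>j\<in>UNIV. B $ k $ j *s X $ j)"
    by (simp add: vec_eq_iff matrix_matrix_mult_def)
  then have "det (\<chi> l. if l = k then (B ** X) $ k else X $ l)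
      = det (\<chi> l. if l = k then (\<Sum>j\<in>UNIV. B $ k $ j *s X $ j) else X $ l)"
    by (rule arg_cong)
  also have "\<dots> = (\<Sum>j\<in>UNIV. B $ k $ j * det (\<chi> l. if l = k then X $ j else X $ l))"
    by (subst det_linear_row_sum[OF finite]) (rule sum.cong[OF refl det_row_mul])
  also have "\<dots> = (\<Sum>j\<in>UNIV. if j = k then B $ k $ k * det X else 0)"
  proof (rule sum.cong[OF refl])
    fix j
    have "det (\<chi> l. if l = k then X $ j else X $ l) = 0" if "j \<noteq> k"
      by (rule det_identical_rows[OF that]) (use that in \<open>auto simp: row_def vec_eq_iff\<close>)
    moreover have "(\<chi> l. if l = k then X $ k else X $ l) = X" by (simp add: vec_eq_iff)
    ultimately show "B $ k $ j * det (\<chi> l. if l = k then X $ j else X $ l) = (if j = k then B $ k $ k * det X else 0)"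
      by auto
  qed
  finally show ?thesis by simp
qed

text \<open>By the product rule the derivative is a sum over the rows, in which row \<open>k\<close> contributes
  \<open>B k k\<close> times the determinant. Only the coefficient matrix at the time \<open>t\<close> enters, so \<open>B\<close> is a
  constant.\<close>

lemma liouville_formula:
  fixes X :: "real \<Rightarrow> real^'n^'n"
  assumes "(X has_vector_derivative B ** X t) (at t within S)"
  shows "((\<lambda>s. det (X s)) has_vector_derivative trace B * det (X t)) (at t within S)"
proof -
  let ?Y = "B ** X t"
  have d: "((\<lambda>s. X s $ a $ b) has_derivative (\<lambda>h. h *\<^sub>R ?Y $ a $ b)) (at t within S)" for a b
    using has_vector_derivative_entry[OF assms] unfolding has_vector_derivative_def .
  have "((\<lambda>s. det (X s)) has_derivative (\<lambda>h. \<Sum>p | p permutes UNIV. of_int (sign p) *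
      (\<Sum>k\<in>UNIV. h *\<^sub>R ?Y $ k $ p k * (\<Prod>l\<in>UNIV - {k}. X t $ l $ p l)))) (at t within S)"
    unfolding det_def
    by (rule has_derivative_sum, rule has_derivative_mult_right, rule has_derivative_prod, rule d)
  moreover have "(\<Sum>p | p permutes UNIV. of_int (sign p) *
      (\<Sum>k\<in>UNIV. h *\<^sub>R ?Y $ k $ p k * (\<Prod>l\<in>UNIV - {k}. X t $ l $ p l)))
    = h *\<^sub>R (trace B * det (X t))" for h
  proof -
    have "(\<Sum>p | p permutes UNIV. of_int (sign p) *
      (\<Sum>k\<in>UNIV. h *\<^sub>R ?Y $ k $ p k * (\<Prod>l\<in>UNIV - {k}. X t $ l $ p l)))
     = h * (\<Sum>p | p permutes UNIV. \<Sum>k\<in>UNIV. of_int (sign p) *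
       (?Y $ k $ p k * (\<Prod>l\<in>UNIV - {k}. X t $ l $ p l)))"
      by (simp add: sum_distrib_left mult_ac)
    also have "\<dots> = h * (\<Sum>k\<in>UNIV. B $ k $ k * det (X t))"
      by (subst sum.swap) (simp only: sum_permutes_row_replaced det_row_of_product)
    finally show ?thesis by (simp add: trace_def sum_distrib_right)
  qed
  ultimately show ?thesis unfolding has_vector_derivative_def by simp
qed

lemma nonincreasing_except_finite:
  fixes g g' :: "real \<Rightarrow> real"
  assumes "finite D" "a \<le> b" "continuous_on {a..b} g"
   "\<And>t. t \<in> {a..b} - D \<Longrightarrow> (g has_vector_derivative g' t) (at t within {a..b})"
   "\<And>t. t \<in> {a..b} - D \<Longrightarrow> g' t \<le> 0"
  shows "g b \<le> g a"
proof -
  (* The integrand is set to zero at the exceptional times, where g' is unconstrained. *)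
  define g'' where "g'' t = (if t \<in> {a..b} - D then g' t else 0)" for t
  have "(g'' has_integral (g b - g a)) {a..b}"
  proof (rule fundamental_theorem_of_calculus_strong)
    show "finite (D \<union> {a,b})" using assms by simp
    fix x assume x: "x \<in> {a..b} - (D \<union> {a,b})"
    then have "at x within {a..b} = at x" by (intro at_within_interior) auto
    then show "(g has_vector_derivative g'' x) (at x)" using x assms(4)[of x] by (auto simp: g''_def)
  qed (use assms in auto)
  then have "g b - g a \<le> 0"
    by (rule has_integral_le[OF _ has_integral_0]) (auto simp: g''_def assms)
  then show ?thesis by simp
qed

text \<open>Gronwall's argument: the differential inequality says that \<open>exp (- C * t) * f t\<close> does not
  increase. The finite exceptional set accounts for the switching times.\<close>

lemma gronwall_zero:
  fixes f f' :: "real \<Rightarrow> real"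
  assumes "finite D" "0 \<le> T" "continuous_on {0..T} f"
   "\<And>t. t \<in> {0..T} - D \<Longrightarrow> (f has_vector_derivative f' t) (at t within {0..T})"
   "\<And>t. t \<in> {0..T} - D \<Longrightarrow> f' t \<le> C * f t" "f 0 = 0"
  shows "f T \<le> 0"
proof -
  let ?g = "\<lambda>t. exp (- C * t) * f t"
  have "?g T \<le> ?g 0"
  proof (rule nonincreasing_except_finite[OF assms(1,2)])
    show "continuous_on {0..T} ?g" by (intro continuous_intros assms)
    fix t assume t: "t \<in> {0..T} - D"
    show "(?g has_vector_derivative exp (- C * t) * (f' t - C * f t)) (at t within {0..T})"
      using assms(4)[OF t] unfolding has_real_derivative_iff_has_vector_derivative[symmetric]
      by (auto intro!: derivative_eq_intros simp: algebra_simps)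
    show "exp (- C * t) * (f' t - C * f t) \<le> 0"
      using assms(5)[OF t] by (simp add: mult_nonneg_nonpos)
  qed
  then show ?thesis using assms(6) by (simp add: mult_le_0_iff)
qed

section \<open>Trajectories of the drift-free system\<close>

text \<open>For \<open>p \<noteq> q\<close> the curve \<open>I + g(t) E p q\<close> is the flow of \<open>s E p q\<close> when \<open>g(t) = c t\<close> with \<open>s = c\<close>, and
  for \<open>p = q\<close> when \<open>g(t) = exp (s t) - 1\<close> with \<open>s = ln (1 + c)\<close>. In both cases a constant control \<open>s\<close>
  leads to \<open>I + c E p q\<close> in unit time.\<close>

lemma elementary_flow_parameter:
  assumes "p = q \<Longrightarrow> c > -1"
  obtains s :: real and g where "\<And>t. (g has_vector_derivative s * (if p = q then 1 + g t else 1)) (at t)"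
    "g 0 = 0" "g 1 = c" "\<And>t. p = q \<Longrightarrow> g t > -1"
proof (cases "p = q")
  case True
  show ?thesis
  proof (rule that[of "\<lambda>t. exp (ln (1 + c) * t) - 1" "ln (1 + c)"])
    fix t
    show "((\<lambda>t. exp (ln (1 + c) * t) - 1) has_vector_derivative
         ln (1 + c) * (if p = q then 1 + (exp (ln (1 + c) * t) - 1) else 1)) (at t)"
      unfolding has_real_derivative_iff_has_vector_derivative[symmetric] using True
      by (auto intro!: derivative_eq_intros)
  qed (use assms True in auto)
next
  case False
  show ?thesis
  proof (rule that[of "\<lambda>t. c * t" c])
    fix t
    show "((\<lambda>t. c * t) has_vector_derivative c * (if p = q then 1 + c * t else 1)) (at t)"
      unfolding has_real_derivative_iff_has_vector_derivative[symmetric] using False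
      by (auto intro!: derivative_eq_intros)
  qed (use False in auto)
qed

lemma elementary_flow_derivative:
  fixes M :: "real^'n^'n" and p q :: 'n
  assumes "(g has_vector_derivative s * (if p = q then 1 + g t else 1)) F"
  shows "((\<lambda>t. elementary p q (g t) ** M) has_vector_derivative
     (s *\<^sub>R matrix_unit p q) ** (elementary p q (g t) ** M)) F"
proof -
  have "(\<lambda>t. elementary p q (g t) ** M) = (\<lambda>t. M + g t *\<^sub>R (matrix_unit p q ** M))"
    by (simp add: elementary_def unit_algebra)
  moreover have "(s *\<^sub>R matrix_unit p q) ** (elementary p q (g t) ** M)
    = (s * (if p = q then 1 + g t else 1)) *\<^sub>R (matrix_unit p q ** M)"
    by (simp add: elementary_def unit_algebra matrix_mul_assoc algebra_simps)
  moreover have "((\<lambda>t. g t *\<^sub>R (matrix_unit p q ** M)) has_vector_derivative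
      (s * (if p = q then 1 + g t else 1)) *\<^sub>R (matrix_unit p q ** M)) F"
    by (rule bounded_linear.has_vector_derivative[OF bounded_linear_scaleR_left assms])
  ultimately show ?thesis
    using has_vector_derivative_add[OF has_vector_derivative_const[of M]] by fastforce
qed

lemma drift_free_reachable_setE:
  fixes i j :: "nat \<Rightarrow> 'n::finite"
  assumes "M \<in> reachable_set 0 m i j"
  obtains T u X D where "0 \<le> T" "\<forall>l\<in>{1..m}. piecewise_constant_on (u l) {0..T}"
    "continuous_on {0..T} X" "X ` {0..T} \<subseteq> GL_plus" "X 0 = mat 1" "X T = M" "finite D"
    "\<forall>t\<in>{0..T} - D. (X has_vector_derivative
       ((\<Sum>l\<in>{1..m}. u l t *\<^sub>R matrix_unit (i l) (j l)) ** X t)) (at t within {0..T})"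
proof -
  obtain T X u where T: "0 \<le> T" and u: "\<forall>k\<in>{1..m}. piecewise_constant_on (u k) {0..T}"
    and X: "trajectory 0 m i j u T X" and M: "X T = M"
    using assms unfolding reachable_set_def reachable_set_at_def by auto
  from X obtain D where "finite D" "\<forall>t\<in>{0..T} - D. (X has_vector_derivative
       ((\<Sum>l\<in>{1..m}. u l t *\<^sub>R matrix_unit (i l) (j l)) ** X t)) (at t within {0..T})"
    unfolding trajectory_def by auto
  then show thesis
    using T u X M that[of T u X D] unfolding trajectory_def by blast
qed

lemma reachable_setI:
  assumes "0 \<le> T" "\<And>l. l \<in> {1..m} \<Longrightarrow> piecewise_constant_on (u l) {0..T}" "trajectory A m i j u T X"
  shows "X T \<in> reachable_set A m i j"
proof -
  have "X T \<in> reachable_set_at A m i j T" unfolding reachable_set_at_def using assms(2,3) by blast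
  then show ?thesis unfolding reachable_set_def using assms(1) by blast
qed

lemma GL_plus_path:
  fixes M :: "real^'n^'n" and a b :: real
  assumes "M \<in> GL_plus" "continuous_on {a..b} Z" "s \<in> {a..b}" "t \<in> {a..b}" "Z s = M"
    "\<And>r. r \<in> {a..b} \<Longrightarrow> det (Z r) \<noteq> 0"
  shows "Z t \<in> GL_plus"
proof -
  have "Topological_Spaces.connected (Z ` {a..b})" by (intro connected_continuous_image assms(2) connected_Icc)
  then have "connected_component {M. invertible M} M (Z t)"
    unfolding connected_component_def using assms by (auto simp: invertible_det_nz)
  then show ?thesis using assms(1) connected_component_trans unfolding GL_plus_def by blast
qed

lemma mat_1_in_GL_plus: "mat 1 \<in> (GL_plus :: (real^'n^'n) set)"
  by (simp add: GL_plus_def invertible_det_nz det_I connected_component_refl)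

lemma continuous_on_det:
  fixes f :: "'a::topological_space \<Rightarrow> real^'n^'n"
  assumes "continuous_on S f" shows "continuous_on S (\<lambda>x. det (f x))"
  unfolding det_def by (intro continuous_intros continuous_on_component assms)

text \<open>On a connected set of invertible matrices the determinant cannot pass through \<open>0\<close>.\<close>

lemma GL_plus_det_pos:
  assumes "M \<in> GL_plus"
  shows "det M > 0"
proof (rule ccontr)
  assume "\<not> det M > 0"
  obtain T :: "(real^'a^'a) set" where T: "Topological_Spaces.connected T" "T \<subseteq> {M. invertible M}" "mat 1 \<in> T" "M \<in> T"
    using assms unfolding GL_plus_def connected_component_def by auto
  have "Topological_Spaces.connected (det ` T)"
    by (intro connected_continuous_image T continuous_on_det continuous_on_id)
  then have "0 \<in> det ` T"
    using T \<open>\<not> det M > 0\<close> connectedD_interval[of "det ` T" "det M" 1 0] by force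
  then show False using T by (auto simp: invertible_det_nz)
qed

lemma elementary_mult_GL_plus:
  assumes "M \<in> GL_plus" "p = q \<Longrightarrow> c > -1"
  shows "elementary p q c ** M \<in> GL_plus"
proof -
  obtain s g where g: "\<And>t. (g has_vector_derivative s * (if p = q then 1 + g t else 1)) (at t)"
    "g 0 = 0" "g 1 = c" "\<And>t. p = q \<Longrightarrow> g t > -1" using elementary_flow_parameter[of p q c] assms by metis
  have "elementary p q (g 1) ** M \<in> GL_plus"
  proof (rule GL_plus_path[OF assms(1), of 0 1 "\<lambda>t. elementary p q (g t) ** M" 0])
    show "continuous_on {0..1} (\<lambda>t. elementary p q (g t) ** M)"
      by (rule continuous_on_vector_derivative, rule has_vector_derivative_at_within,
          rule elementary_flow_derivative, rule g(1))
    show "det (elementary p q (g r) ** M) \<noteq> 0" for r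
      using GL_plus_det_pos[OF assms(1)] g(4)[of r] by (auto simp: det_mul det_elementary)
  qed (auto simp: g elementary_def)
  then show ?thesis using g by simp
qed

text \<open>Any trajectory can be prolonged by one unit of time during which a single control is switched on
  and all others are off; this multiplies the terminal point by the chosen elementary matrix.\<close>

lemma reachable_set_elementary_mult:
  fixes M :: "real^'n^'n" and i j :: "nat \<Rightarrow> 'n"
  assumes M: "M \<in> reachable_set 0 m i j" and k: "k \<in> {1..m}" "i k = j k \<Longrightarrow> c > -1"
  shows "elementary (i k) (j k) c ** M \<in> reachable_set 0 m i j"
proof -
  let ?p = "i k" and ?q = "j k"
  obtain T u X D where T: "0 \<le> T" and u: "\<forall>l\<in>{1..m}. piecewise_constant_on (u l) {0..T}"
    and X: "continuous_on {0..T} X" "X ` {0..T} \<subseteq> GL_plus" "X 0 = mat 1" "X T = M"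
    and D: "finite D" and X': "\<forall>t\<in>{0..T} - D. (X has_vector_derivative
           ((\<Sum>l\<in>{1..m}. u l t *\<^sub>R matrix_unit (i l) (j l)) ** X t)) (at t within {0..T})"
    by (rule drift_free_reachable_setE[OF M]) (rule that)
  obtain s g where g: "\<And>t. (g has_vector_derivative s * (if ?p = ?q then 1 + g t else 1)) (at t)"
    "g 0 = 0" "g 1 = c" "\<And>t. ?p = ?q \<Longrightarrow> g t > -1" using elementary_flow_parameter[of ?p ?q c] k by metis
  (* The new piece Z runs after time T, which joins the switching times. *)
  define Z where "Z t = elementary ?p ?q (g (t - T)) ** M" for t
  define Y where "Y t = (if t \<le> T then X t else Z t)" for t
  define w where "w l t = (if t \<le> T then u l t else if l = k then s else 0)" for l t
  have Z': "(Z has_vector_derivative (s *\<^sub>R matrix_unit ?p ?q) ** Z t) (at t within S)" for t S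
  proof -
    have "((\<lambda>t. g (t - T)) has_vector_derivative s * (if ?p = ?q then 1 + g (t - T) else 1)) (at t within S)"
      using g(1)[of "t - T"] DERIV_shift[of g _ t "- T"]
      unfolding has_real_derivative_iff_has_vector_derivative[symmetric]
      by (simp add: has_field_derivative_at_within)
    then show ?thesis unfolding Z_def by (rule elementary_flow_derivative)
  qed
  have Zc: "continuous_on S Z" for S
    by (rule continuous_on_vector_derivative[OF Z'])
  have ZT: "Z T = M" by (simp add: Z_def g elementary_def)
  have MG: "M \<in> GL_plus" using X T by auto
  have ZG: "Z t \<in> GL_plus" for t
    unfolding Z_def by (rule elementary_mult_GL_plus[OF MG g(4)])
  have "piecewise_constant_on (w l) {0..T+1}" if l: "l \<in> {1..m}" for l
  proof -
    obtain E where E: "finite E" "\<forall>a b. {a..b} \<subseteq> {0..T} - E \<longrightarrow> u l constant_on {a..b}"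
      using bspec[OF u l] unfolding piecewise_constant_on_def by (elim exE conjE) (rule that)
    have "w l constant_on {a..b}" if ab: "{a..b} \<subseteq> {0..T+1} - insert T E" for a b
    proof -
      have "T \<notin> {a..b}" using ab by blast
      then consider "b < T" | "T < a" | "\<not> a \<le> b" by fastforce
      then show ?thesis
      proof cases
        case 1
        have "{a..b} \<subseteq> {0..T} - E"
        proof
          fix x assume "x \<in> {a..b}"
          moreover from subsetD[OF ab this] have "x \<in> {0..T+1}" "x \<notin> E" by blast+
          ultimately show "x \<in> {0..T} - E" using 1 by auto
        qed
        from E(2)[rule_format, OF this] show ?thesis using 1 by (auto simp: w_def constant_on_def)
      qed (auto simp: w_def constant_on_def)
    qed
    then show ?thesis unfolding piecewise_constant_on_def using E(1)
      by (intro exI[of _ "insert T E"]) blast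
  qed
  moreover have "trajectory 0 m i j w (T+1) Y"
    unfolding trajectory_def
  proof (intro conjI exI ballI)
    have "{0..T+1} = {0..T} \<union> {T..T+1}" using T by auto
    moreover have "continuous_on ({0..T} \<union> {T..T+1}) Y" unfolding Y_def
      by (rule continuous_on_cases) (use X Zc ZT in auto)
    ultimately show "continuous_on {0..T+1} Y" by simp
    show "Y ` {0..T+1} \<subseteq> GL_plus" using X ZG by (auto simp: Y_def)
    show "Y 0 = mat 1" using X T by (simp add: Y_def)
    show "finite (insert T D)" using D by simp
    fix t assume t: "t \<in> {0..T+1} - insert T D"
    have "(Y has_vector_derivative (\<Sum>l\<in>{1..m}. w l t *\<^sub>R matrix_unit (i l) (j l)) ** Y t) (at t within {0..T+1})"
    proof (cases "t < T")
      case True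
      have "(X has_vector_derivative ((\<Sum>l\<in>{1..m}. u l t *\<^sub>R matrix_unit (i l) (j l)) ** X t)) (at t within {0..T+1})"
        using bspec[OF X', of t] t True at_within_nhd[of t "{..<T}" "{0..T+1}" "{0..T}"] by force
      then have "(Y has_vector_derivative ((\<Sum>l\<in>{1..m}. u l t *\<^sub>R matrix_unit (i l) (j l)) ** X t)) (at t within {0..T+1})"
        by (rule has_vector_derivative_transform_within[where d = "T - t"]) (use True t in \<open>auto simp: Y_def dist_real_def\<close>)
      then show ?thesis using True by (simp add: w_def Y_def)
    next
      case False
      then have tT: "t > T" using t by auto
      have "(Y has_vector_derivative (s *\<^sub>R matrix_unit ?p ?q) ** Z t) (at t within {0..T+1})"
        by (rule has_vector_derivative_transform_within[OF Z', where d = "t - T"]) (use tT t in \<open>auto simp: Y_def dist_real_def\<close>)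
      moreover have "(\<Sum>l\<in>{1..m}. w l t *\<^sub>R matrix_unit (i l) (j l)) = (\<Sum>l\<in>{1..m}. if l = k then s *\<^sub>R matrix_unit ?p ?q else 0)"
        by (rule sum.cong) (use tT in \<open>auto simp: w_def\<close>)
      ultimately show ?thesis using tT k by (simp add: Y_def)
    qed
    then show "(Y has_vector_derivative 0 ** Y t + (\<Sum>l\<in>{1..m}. w l t *\<^sub>R matrix_unit (i l) (j l)) ** Y t) (at t within {0..T+1})"
      by simp
  qed
  moreover have "Y (T + 1) = elementary ?p ?q c ** M" by (simp add: Y_def Z_def g)
  ultimately show ?thesis using reachable_setI[of "T + 1" m w 0 i j Y] T by simp
qed

lemma mat_1_in_reachable_set: "mat 1 \<in> reachable_set 0 m i j"
proof -
  have "trajectory 0 m i j (\<lambda>_ _. 0) 0 (\<lambda>_. mat 1)"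
    unfolding trajectory_def using mat_1_in_GL_plus by (auto intro!: exI[of _ "{0}"])
  moreover have "piecewise_constant_on (\<lambda>_. 0) {0..0}"
    unfolding piecewise_constant_on_def constant_on_def by auto
  ultimately show ?thesis unfolding reachable_set_def reachable_set_at_def by force
qed

lemma arc_products_reachable:
  "arc_products (parcs (controlled_graph m i j)) \<subseteq> reachable_set 0 m i j"
proof
  fix M assume "M \<in> arc_products (parcs (controlled_graph m i j))"
  then show "M \<in> reachable_set 0 m i j"
    by induction (auto simp: mat_1_in_reachable_set controlled_graph_def intro: reachable_set_elementary_mult)
qed

section \<open>Invariants of the reachable set\<close>

text \<open>Without self-loops all coefficient matrices have trace zero.\<close>

lemma reachable_det_1:
  assumes "M \<in> reachable_set 0 m i j" "\<not> has_self_loop (controlled_graph m i j)"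
  shows "det M = 1"
proof -
  obtain T u X D where T: "0 \<le> T" and u: "\<forall>l\<in>{1..m}. piecewise_constant_on (u l) {0..T}"
    and X: "continuous_on {0..T} X" "X ` {0..T} \<subseteq> GL_plus" "X 0 = mat 1" "X T = M"
    and D: "finite D" and X': "\<forall>t\<in>{0..T} - D. (X has_vector_derivative
           ((\<Sum>l\<in>{1..m}. u l t *\<^sub>R matrix_unit (i l) (j l)) ** X t)) (at t within {0..T})"
    by (rule drift_free_reachable_setE[OF assms(1)]) (rule that)
  have "\<And>k. k \<in> {1..m} \<Longrightarrow> i k \<noteq> j k"
    using assms(2) unfolding has_self_loop_def controlled_graph_def by force
  then have tr: "trace (\<Sum>l\<in>{1..m}. u l t *\<^sub>R matrix_unit (i l) (j l)) = 0" for t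
    by (auto simp: trace_def matrix_unit_def intro!: sum.neutral)
  show ?thesis unfolding X(4)[symmetric]
  proof (rule has_derivative_zero_unique_strong_interval
        [OF D, where f = "\<lambda>t. det (X t)" and a = 0 and b = T])
    show "continuous_on {0..T} (\<lambda>t. det (X t))" by (intro continuous_on_det X)
    fix t assume "t \<in> {0..T} - D"
    from liouville_formula[OF bspec[OF X' this]] show "((\<lambda>t. det (X t)) has_derivative (\<lambda>h. 0)) (at t within {0..T})"
      unfolding has_vector_derivative_def tr by simp
  qed (use T X in auto)
qed

lemma weighted_product_bound:
  fixes b x y L :: real
  assumes "\<bar>b\<bar> \<le> L" shows "2 * (b * y * x) \<le> L * (x\<^sup>2 + y\<^sup>2)"
proof -
  have "2 * (b * y * x) = b * (2 * x * y)" by simp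
  also have "\<dots> \<le> \<bar>b\<bar> * \<bar>2 * x * y\<bar>" using abs_ge_self[of "b * (2 * x * y)"] by (simp only: abs_mult)
  also have "\<dots> \<le> L * (x\<^sup>2 + y\<^sup>2)"
    using assms sum_squares_bound[of x y] sum_squares_bound[of x "- y"]
    by (intro mult_mono) (auto simp: abs_le_iff)
  finally show ?thesis .
qed

text \<open>Let \<open>S\<close> be the set of nodes reachable from \<open>p\<close>. The coefficient matrix couples a row in \<open>S\<close> only
  to rows in \<open>S\<close>, so the entries \<open>X a q\<close> with \<open>a\<close> in \<open>S\<close> form a linear system of their own. As \<open>q\<close> is not in
  \<open>S\<close>, they all start at \<open>0\<close>. Bounded controls allow Gronwall's argument for the sum of their squares,
  which shows that they stay \<open>0\<close>.\<close>

lemma reachable_entry_0: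
  fixes i j :: "nat \<Rightarrow> 'n::finite"
  assumes "M \<in> reachable_set 0 m i j" "(p, q) \<notin> (parcs (controlled_graph m i j))\<^sup>*"
  shows "M $ p $ q = 0"
proof -
  let ?R = "parcs (controlled_graph m i j)"
  obtain T u X D where T: "0 \<le> T" and u: "\<forall>l\<in>{1..m}. piecewise_constant_on (u l) {0..T}"
    and X: "continuous_on {0..T} X" "X ` {0..T} \<subseteq> GL_plus" "X 0 = mat 1" "X T = M"
    and D: "finite D" and X': "\<forall>t\<in>{0..T} - D. (X has_vector_derivative
           ((\<Sum>l\<in>{1..m}. u l t *\<^sub>R matrix_unit (i l) (j l)) ** X t)) (at t within {0..T})"
    by (rule drift_free_reachable_setE[OF assms(1)]) (rule that)
  define B where "B t = (\<Sum>l\<in>{1..m}. u l t *\<^sub>R matrix_unit (i l) (j l))" for t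
  have B_nth: "B t $ a $ c = (\<Sum>l\<in>{1..m}. u l t * (if a = i l \<and> c = j l then 1 else 0))" for t a c
    by (simp add: B_def matrix_unit_def)
  have B0: "B t $ a $ c = 0" if "(a, c) \<notin> ?R" for t a c
  proof -
    have "u l t * (if a = i l \<and> c = j l then 1 else 0) = 0" if "l \<in> {1..m}" for l
      using that \<open>(a, c) \<notin> ?R\<close> by (auto simp: controlled_graph_def)
    then show ?thesis unfolding B_nth by (intro sum.neutral ballI)
  qed
  define S where "S = {a. (p, a) \<in> ?R\<^sup>*}"
  have S: "c \<in> S" if "a \<in> S" "(a, c) \<in> ?R" for a c using that unfolding S_def by auto
  have "\<exists>K. \<forall>t\<in>{0..T}. \<bar>u l t\<bar> \<le> K" if "l \<in> {1..m}" for l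
    using finite_imp_bounded[OF piecewise_constant_on_finite_image[OF bspec[OF u that]]] by (auto simp: bounded_iff)
  then obtain K where K: "\<And>l t. l \<in> {1..m} \<Longrightarrow> t \<in> {0..T} \<Longrightarrow> \<bar>u l t\<bar> \<le> K l" by metis
  define L where "L = (\<Sum>l\<in>{1..m}. K l)"
  have BL: "\<bar>B t $ a $ c\<bar> \<le> L" if "t \<in> {0..T}" for t a c
    unfolding B_nth L_def
  proof (rule order_trans[OF sum_abs sum_mono])
    fix l assume "l \<in> {1..m}"
    from K[OF this that] show "\<bar>u l t * (if a = i l \<and> c = j l then 1 else 0)\<bar> \<le> K l" by auto
  qed
  define f where "f t = (\<Sum>a\<in>S. (X t $ a $ q)\<^sup>2)" for t
  have X'q: "((\<lambda>t. X t $ a $ q) has_vector_derivative (\<Sum>c\<in>S. B t $ a $ c * X t $ c $ q)) (at t within {0..T})"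
    if "a \<in> S" "t \<in> {0..T} - D" for a t
  proof -
    have "(B t ** X t) $ a $ q = (\<Sum>c\<in>UNIV. B t $ a $ c * X t $ c $ q)"
      by (simp add: matrix_matrix_mult_def)
    also have "\<dots> = (\<Sum>c\<in>S. B t $ a $ c * X t $ c $ q)"
      using S[OF that(1)] B0 by (intro sum.mono_neutral_right) auto
    finally show ?thesis using has_vector_derivative_entry[OF bspec[OF X' that(2)], of a q] by (simp add: B_def)
  qed
  have "f T \<le> 0"
  proof (rule gronwall_zero[OF D T])
    show "continuous_on {0..T} f" unfolding f_def by (intro continuous_intros X)
    show "f 0 = 0" using assms(2) X by (auto simp: f_def S_def mat_def intro!: sum.neutral)
    fix t assume t: "t \<in> {0..T} - D"
    show "(f has_vector_derivative (\<Sum>a\<in>S. \<Sum>c\<in>S. 2 * (B t $ a $ c * X t $ c $ q * X t $ a $ q))) (at t within {0..T})"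
      unfolding f_def has_real_derivative_iff_has_vector_derivative[symmetric]
    proof (rule DERIV_sum)
      fix a assume "a \<in> S"
      from X'q[OF this t] show "((\<lambda>t. (X t $ a $ q)\<^sup>2) has_real_derivative (\<Sum>c\<in>S. 2 * (B t $ a $ c * X t $ c $ q * X t $ a $ q))) (at t within {0..T})"
        unfolding has_real_derivative_iff_has_vector_derivative[symmetric]
        by (auto intro!: derivative_eq_intros simp: sum_distrib_left sum_distrib_right mult_ac)
    qed
    have "2 * (B t $ a $ c * X t $ c $ q * X t $ a $ q) \<le> L * ((X t $ a $ q)\<^sup>2 + (X t $ c $ q)\<^sup>2)" for a c
      using t by (intro weighted_product_bound BL) simp
    then have "(\<Sum>a\<in>S. \<Sum>c\<in>S. 2 * (B t $ a $ c * X t $ c $ q * X t $ a $ q)) \<le> (\<Sum>a\<in>S. \<Sum>c\<in>S. L * ((X t $ a $ q)\<^sup>2 + (X t $ c $ q)\<^sup>2))"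
      by (intro sum_mono)
    also have "\<dots> = (\<Sum>a\<in>S. L * (card S * (X t $ a $ q)\<^sup>2 + f t))"
      by (simp add: f_def sum.distrib flip: sum_distrib_left)
    also have "\<dots> = L * (card S * f t + card S * f t)"
      by (simp add: f_def sum.distrib flip: sum_distrib_left)
    also have "\<dots> = (2 * L * card S) * f t" by simp
    finally show "(\<Sum>a\<in>S. \<Sum>c\<in>S. 2 * (B t $ a $ c * X t $ c $ q * X t $ a $ q)) \<le> (2 * L * card S) * f t" .
  qed
  moreover have "(M $ p $ q)\<^sup>2 \<le> f T"
    unfolding f_def X(4)[symmetric] by (rule member_le_sum) (auto simp: S_def)
  ultimately have "(M $ p $ q)\<^sup>2 \<le> 0" by (rule order_trans[rotated])
  then show ?thesis by simp
qed

section \<open>The controllability criterion\<close>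

lemma strongly_connected_iff_rtrancl:
  "strongly_connected (with_proj (controlled_graph m i j)) \<longleftrightarrow> (\<forall>p q. (p, q) \<in> (parcs (controlled_graph m i j))\<^sup>*)"
proof -
  have "rtrancl_on UNIV R = R\<^sup>*" for R :: "'a rel"
    using rtrancl_on_rtranclI[of _ _ UNIV R] rtrancl_consistent_rtrancl_on[of _ _ R UNIV] by auto
  then show ?thesis
    by (simp add: strongly_connected_def reachable_def controlled_graph_def arcs_ends_conv)
qed

theorem proposition3:
  fixes A :: "real^'n^'n" and m :: nat and i j :: "nat \<Rightarrow> 'n"
  assumes "A = 0"
  shows "controllable A m i j \<longleftrightarrow>
    strongly_connected (with_proj (controlled_graph m i j)) \<and> has_self_loop (controlled_graph m i j)"
proof -
  let ?G = "controlled_graph m i j"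
  have sub: "reachable_set 0 m i j \<subseteq> GL_plus"
    unfolding reachable_set_def reachable_set_at_def trajectory_def by auto
  have "strongly_connected (with_proj ?G) \<and> has_self_loop ?G" if *: "reachable_set 0 m i j = GL_plus"
  proof
    have E: "elementary p q 1 \<in> reachable_set 0 m i j" for p q
      using elementary_mult_GL_plus[OF mat_1_in_GL_plus, of p q 1] * by simp
    show "strongly_connected (with_proj ?G)" unfolding strongly_connected_iff_rtrancl
    proof (rule ccontr)
      assume "\<not> (\<forall>p q. (p, q) \<in> (parcs ?G)\<^sup>*)"
      then obtain p q where pq: "(p, q) \<notin> (parcs ?G)\<^sup>*" by blast
      then have "p \<noteq> q" by auto
      then show False using reachable_entry_0[OF E pq, of p q] by (simp add: elementary_nth)
    qed
    show "has_self_loop ?G"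
    proof (rule ccontr)
      fix v :: 'n
      assume "\<not> has_self_loop ?G"
      from reachable_det_1[OF E this, of v v] show False by (simp add: det_elementary)
    qed
  qed
  moreover have "GL_plus \<subseteq> reachable_set 0 m i j" if sc: "strongly_connected (with_proj ?G)" and hl: "has_self_loop ?G"
  proof -
    obtain v where "(v, v) \<in> parcs ?G" using hl unfolding has_self_loop_def by blast
    then have "arc_products UNIV \<subseteq> arc_products (parcs ?G)"
      using sc unfolding strongly_connected_iff_rtrancl by (intro arc_products_UNIV_subset) auto
    then show ?thesis using det_pos_in_arc_products GL_plus_det_pos arc_products_reachable by blast
  qed
  ultimately show ?thesis unfolding assms controllable_def using sub by blast
qed

end
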